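(* For $k\in\mathbb{N}_0$ and $a>0$, \[ \int_0^\infty \frac{x\ln x\,dx}{(x-1)(x+a)^{k+2}} = \frac{\pi^2+\ln^2 a}{2(a+1)^{k+2}} + \frac{\ln a}{(k+1)(a+1)^{k+1}} + \frac{1}{(k+1)(a+1)^{k+1}}\sum_{j=0}^{k-1}\frac{(1+1/a)^{j+1}}{j+1}\left(\frac{k-j}{a+1}\,(H_j-\ln a) - 1\right). \]
   Context: $H_n=\sum_{i=1}^n \frac1i$ denotes the $n$-th harmonic number, with $H_0=0$. Empty sums are zero. *)

theory Defs
  imports "HOL-Analysis.Analysis"
begin

end

theory Submission
  imports Defs "HOL-Real_Asymp.Real_Asymp"
begin

text \<open>
  Write \<open>G\<^sub>n\<close> and \<open>L\<^sub>n\<close> for the integrals over \<open>(0, \<infinity>)\<close> of \<open>ln x / ((x - 1) (x + a)\<^sup>n)\<close> and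
  \<open>ln x / (x + a)\<^sup>n\<close>. Since \<open>x = (x - 1) + 1\<close>, the integral sought is \<open>L\<^sub>k\<^sub>+\<^sub>2 + G\<^sub>k\<^sub>+\<^sub>2\<close>, and partial
  fractions give \<open>(a + 1) G\<^sub>n\<^sub>+\<^sub>1 = G\<^sub>n - L\<^sub>n\<^sub>+\<^sub>1\<close>. The \<open>L\<^sub>n\<close> follow from the derivative of
  \<open>x ln x / (x + a)\<^sup>n\<close>. For \<open>G\<^sub>1\<close>, the case \<open>a = 1\<close> reduces by \<open>x \<mapsto> 1 / x\<close> to the unit interval,
  where the geometric series leads to the sum of the inverse odd squares; for general \<open>a\<close>,
  \<open>(a + 1) G\<^sub>1\<close> differs from its value at \<open>a = 1\<close> by the integral of
  \<open>(a - 1) ln x / ((x + 1) (x + a))\<close>, which the substitution \<open>x \<mapsto> a / x\<close> evaluates.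
\<close>

section \<open>Improper integrals from antiderivatives with endpoint limits\<close>

text \<open>For a nonnegative integrand, finite endpoint limits of the antiderivative already yield
  Lebesgue integrability; the result is transferred to \<open>has_integral\<close>.\<close>

lemma has_integral_FTC_einterval_nonneg:
  fixes f F :: "real \<Rightarrow> real" and a b :: ereal
  assumes "a < b"
    and "\<And>x. x \<in> einterval a b \<Longrightarrow> DERIV F x :> f x"
    and "\<And>x. x \<in> einterval a b \<Longrightarrow> isCont f x"
    and "\<And>x. x \<in> einterval a b \<Longrightarrow> 0 \<le> f x"
    and "((F \<circ> real_of_ereal) \<longlongrightarrow> A) (at_right a)"
    and "((F \<circ> real_of_ereal) \<longlongrightarrow> B) (at_left b)"
  shows "(f has_integral (B - A)) (einterval a b)"
proof -
  have "set_integrable lborel (einterval a b) f" "(LBINT x=a..b. f x) = B - A"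
    using assms
    by (intro interval_integral_FTC_nonneg[where F = F] AE_I2; auto simp: einterval_iff)+
  with \<open>a < b\<close> show ?thesis
    by (metis has_integral_iff interval_lebesgue_integral_def less_imp_le set_borel_integral_eq_integral)
qed

lemma has_integral_FTC_Ioo_nonneg:
  fixes f F :: "real \<Rightarrow> real" and a b :: real
  assumes "a < b"
    and "\<And>x. a < x \<Longrightarrow> x < b \<Longrightarrow> DERIV F x :> f x"
    and "\<And>x. a < x \<Longrightarrow> x < b \<Longrightarrow> isCont f x"
    and "\<And>x. a < x \<Longrightarrow> x < b \<Longrightarrow> 0 \<le> f x"
    and "(F \<longlongrightarrow> A) (at_right a)" and "(F \<longlongrightarrow> B) (at_left b)"
  shows "(f has_integral (B - A)) {a<..<b}"
proof -
  have "(f has_integral (B - A)) (einterval (ereal a) (ereal b))"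
    using assms
    by (intro has_integral_FTC_einterval_nonneg[where F = F])
       (auto simp: ereal_tendsto_simps)
  then show ?thesis by simp
qed

lemma has_integral_FTC_Ioi_nonneg:
  fixes f F :: "real \<Rightarrow> real" and a :: real
  assumes "\<And>x. a < x \<Longrightarrow> DERIV F x :> f x"
    and "\<And>x. a < x \<Longrightarrow> isCont f x"
    and "\<And>x. a < x \<Longrightarrow> 0 \<le> f x"
    and "(F \<longlongrightarrow> A) (at_right a)" and "(F \<longlongrightarrow> B) at_top"
  shows "(f has_integral (B - A)) {a<..}"
proof -
  have "(f has_integral (B - A)) (einterval (ereal a) \<infinity>)"
    using assms
    by (intro has_integral_FTC_einterval_nonneg[where F = F])
       (auto simp: ereal_tendsto_simps)
  then show ?thesis by simp
qed

text \<open>The point 1 is negligible. It is the natural cut because \<open>ln x\<close> changes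
  sign there and \<open>x - 1\<close> vanishes.\<close>

lemma has_integral_Ioi_split:
  fixes f :: "real \<Rightarrow> real"
  assumes "(f has_integral I) {0<..<1}" and "(f has_integral J) {1<..}"
  shows "(f has_integral (I + J)) {0<..}"
proof -
  have "{0<..<1} \<inter> {1<..} = ({} :: real set)" by auto
  then have "(f has_integral (I + J)) ({0<..<1} \<union> {1<..})"
    using assms by (intro has_integral_Un) auto
  moreover have "{0<..<1} \<union> {1<..} = {0<..} - {1::real}" by auto
  ultimately have "(f has_integral (I + J)) ({0<..} - {1})" by simp
  then show ?thesis
    by (rule has_integral_spike_set_eq[THEN iffD1, rotated 2])
       (auto intro: negligible_subset[of "{1}"])
qed

text \<open>The nonnegative version applies to \<open>- f\<close> on (0, 1) and to \<open>f\<close>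
  beyond 1. The same two integrals, added without the sign correction, integrate the absolute
  value.\<close>

lemma has_integral_FTC_Ioi_sign_change:
  fixes f F :: "real \<Rightarrow> real"
  assumes deriv: "\<And>x. 0 < x \<Longrightarrow> DERIV F x :> f x"
    and cont: "\<And>x. 0 < x \<Longrightarrow> isCont f x"
    and neg: "\<And>x. 0 < x \<Longrightarrow> x < 1 \<Longrightarrow> f x \<le> 0"
    and pos: "\<And>x. 1 < x \<Longrightarrow> 0 \<le> f x"
    and A: "(F \<longlongrightarrow> A) (at_right 0)" and B: "(F \<longlongrightarrow> B) at_top"
  shows "(f has_integral (B - A)) {0<..}" and "f absolutely_integrable_on {0<..}"
proof -
  have "isCont F 1" using deriv[of 1] by (auto intro: DERIV_isCont)
  then have F1: "(F \<longlongrightarrow> F 1) (at_left 1)" "(F \<longlongrightarrow> F 1) (at_right 1)"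
    by (auto simp: isCont_def intro: filterlim_at_split[THEN iffD1, THEN conjunct1]
        filterlim_at_split[THEN iffD1, THEN conjunct2])
  have 1: "((\<lambda>x. - f x) has_integral (- F 1 - - A)) {0<..<1}"
    by (rule has_integral_FTC_Ioo_nonneg[where F = "\<lambda>x. - F x"])
       (use deriv cont neg F1 A in \<open>auto intro!: tendsto_minus derivative_intros continuous_intros\<close>)
  have 2: "(f has_integral (B - F 1)) {1<..}"
    by (rule has_integral_FTC_Ioi_nonneg[where F = F]) (use deriv cont pos F1 B in auto)
  have 3: "(f has_integral (F 1 - A)) {0<..<1}"
    using has_integral_neg[OF 1] by simp
  show 4: "(f has_integral (B - A)) {0<..}"
    using has_integral_Ioi_split[OF 3 2] by simp
  have "((\<lambda>x. \<bar>f x\<bar>) has_integral (- F 1 - - A)) {0<..<1}"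
    using 1 by (rule has_integral_eq[rotated]) (use neg in force)
  moreover have "((\<lambda>x. \<bar>f x\<bar>) has_integral (B - F 1)) {1<..}"
    using 2 by (rule has_integral_eq[rotated]) (use pos in force)
  ultimately have "(\<lambda>x. \<bar>f x\<bar>) integrable_on {0<..}"
    using has_integral_Ioi_split by blast
  with 4 show "f absolutely_integrable_on {0<..}"
    by (auto simp: absolutely_integrable_on_def)
qed

section \<open>Integrals of \<open>ln x / (x + a) ^ n\<close>\<close>

lemma DERIV_inverse_linear_power:
  fixes a x :: real
  assumes "x + a \<noteq> 0"
  shows "DERIV (\<lambda>x. 1 / (x + a) ^ Suc n) x :> - (real n + 1) / (x + a) ^ (n + 2)"
proof -
  have "DERIV (\<lambda>x. (x + a) ^ Suc n) x :> (real n + 1) * (x + a) ^ n"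
    by (rule DERIV_cong[OF DERIV_power[OF DERIV_add[OF DERIV_ident DERIV_const]]]) simp
  then show ?thesis
    by (rule DERIV_cong[OF DERIV_divide[OF DERIV_const]]) (use assms in \<open>simp_all add: divide_simps\<close>)
qed

text \<open>Differentiating \<open>x * ln x / (x + a) ^ (m + 2)\<close> and writing
  \<open>x = (x + a) - a\<close> expresses the integrand for \<open>m + 1\<close> through the one
  for \<open>m\<close> and a pure power. At 0 the antiderivative of that power contributes the
  increment \<open>1 / (m + 1)\<close> of the harmonic number. Only the derivative and the two
  limits matter later, hence the existential form.\<close>

lemma antiderivative_ln_over_power:
  fixes a :: real and m :: nat
  assumes "a > 0"
  shows "\<exists>P. (\<forall>x>0. DERIV P x :> ln x / (x + a) ^ (m + 2)) \<and>
             (P \<longlongrightarrow> (harm m - ln a) / ((real m + 1) * a ^ (m + 1))) (at_right 0) \<and>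
             (P \<longlongrightarrow> 0) at_top"
proof (induction m)
  case 0
  \<comment> \<open>Integration by parts, with \<open>x / (a * (x + a))\<close> as the
    antiderivative of \<open>1 / (x + a)^2\<close> because it vanishes at 0 and tames
    \<open>ln x\<close>.\<close>
  let ?P = "\<lambda>x. (x * ln x / (x + a) - ln (x + a)) / a"
  have "DERIV ?P x :> ln x / (x + a) ^ (0 + 2)" if "x > 0" for x
  proof -
    have y: "x + a \<noteq> 0" using that assms by simp
    have "DERIV ?P x :> (((ln x + 1) * (x + a) - x * ln x) / ((x + a) * (x + a)) - 1 / (x + a)) / a"
      using that assms by (auto intro!: derivative_eq_intros)
    also have "(((ln x + 1) * (x + a) - x * ln x) / ((x + a) * (x + a)) - 1 / (x + a)) / a
        = ln x / (x + a) ^ (0 + 2)"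
      using y assms by (simp add: divide_simps power2_eq_square) (simp add: algebra_simps)
    finally show ?thesis .
  qed
  moreover have "(?P \<longlongrightarrow> (harm 0 - ln a) / ((real 0 + 1) * a ^ (0 + 1))) (at_right 0)"
  proof -
    have "((\<lambda>x::real. x * ln x) \<longlongrightarrow> 0) (at_right 0)" by real_asymp
    with assms have "(?P \<longlongrightarrow> (0 / (0 + a) - ln (0 + a)) / a) (at_right 0)"
      by (intro tendsto_intros) auto
    then show ?thesis by (simp add: harm_def)
  qed
  moreover have "(?P \<longlongrightarrow> 0) at_top"
  proof -
    have "((\<lambda>x. x * ln x / (x + a) - ln (x + a)) \<longlongrightarrow> 0) at_top"
      using assms by real_asymp
    from tendsto_divide[OF this tendsto_const[of a]] assms show ?thesis by simp
  qed
  ultimately show ?case by blast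
next
  case (Suc m)
  then obtain P where P: "\<And>x. x > 0 \<Longrightarrow> DERIV P x :> ln x / (x + a) ^ (m + 2)"
    "(P \<longlongrightarrow> (harm m - ln a) / ((real m + 1) * a ^ (m + 1))) (at_right 0)" "(P \<longlongrightarrow> 0) at_top"
    by blast
  let ?P = "\<lambda>x. (x * ln x / (x + a) ^ (m + 2) + (real m + 1) * P x
                  + 1 / ((real m + 1) * (x + a) ^ (m + 1))) / ((real m + 2) * a)"
  have "DERIV ?P x :> ln x / (x + a) ^ (Suc m + 2)" if "x > 0" for x
  proof -
    define y where "y = x + a"
    have y: "x + a \<noteq> 0" "y \<noteq> 0" using that assms by (simp_all add: y_def)
    have "DERIV (\<lambda>x. x * ln x) x :> ln x + 1"
      using that by (auto intro!: derivative_eq_intros)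
    from DERIV_mult[OF this DERIV_inverse_linear_power[OF y(1), of "Suc m"]]
    have 1: "DERIV (\<lambda>x. x * ln x / (x + a) ^ (m + 2)) x :>
        (ln x + 1) / y ^ (m + 2) - (real m + 2) * (x * ln x) / y ^ (m + 3)"
      unfolding y_def
      by (simp add: eval_nat_numeral add.commute) (simp add: algebra_simps add_divide_distrib diff_divide_distrib)
    have "- (real m + 1) / y ^ (m + 2) / (real m + 1) = - (1 / y ^ (m + 2))"
      by (simp add: divide_simps)
    with DERIV_cdivide[OF DERIV_inverse_linear_power[OF y(1), of m], of "real m + 1"]
    have 2: "DERIV (\<lambda>x. 1 / ((real m + 1) * (x + a) ^ (m + 1))) x :> - (1 / y ^ (m + 2))"
      by (simp add: mult.commute y_def)
    have "((ln x + 1) / y ^ (m + 2) - (real m + 2) * (x * ln x) / y ^ (m + 3)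
        + (real m + 1) * (ln x / y ^ (m + 2)) + - (1 / y ^ (m + 2))) / ((real m + 2) * a)
        = ln x / y ^ (Suc m + 2)"
    proof -
      define r where "r = 1 / y ^ (m + 2)"
      have r: "t / y ^ (m + 2) = t * r" "t / y ^ (m + 3) = t * (r / y)"
        "t / y ^ (Suc m + 2) = t * (r / y)" for t
        using y by (simp_all add: r_def eval_nat_numeral)
      have "(ln x + 1) * r - (real m + 2) * (x * ln x) * (r / y)
            + (real m + 1) * (ln x * r) + - (1 * r) = (real m + 2) * ln x * r * (1 - x / y)"
        by (simp add: algebra_simps)
      \<comment> \<open>The resulting factor \<open>a\<close> cancels the one in the denominator of
        \<open>?P\<close>, and \<open>1 / y\<close> raises the exponent by one.\<close>
      also have "1 - x / y = a / y" using y by (simp add: y_def field_simps)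
      finally show ?thesis unfolding r using assms by simp
    qed
    then show ?thesis
      by (intro DERIV_cong[OF DERIV_cdivide[OF DERIV_add[OF DERIV_add[OF 1 DERIV_cmult[OF P(1)[OF that]]] 2]]])
         (simp only: y_def)
  qed
  moreover have "(?P \<longlongrightarrow> (harm (Suc m) - ln a) / ((real (Suc m) + 1) * a ^ (Suc m + 1))) (at_right 0)"
  proof -
    have "((\<lambda>x::real. x * ln x) \<longlongrightarrow> 0) (at_right 0)" by real_asymp
    then have "(?P \<longlongrightarrow> (0 / (0 + a) ^ (m + 2) + (real m + 1) * ((harm m - ln a) / ((real m + 1) * a ^ (m + 1)))
                  + 1 / ((real m + 1) * (0 + a) ^ (m + 1))) / ((real m + 2) * a)) (at_right 0)"
      using assms by (intro tendsto_intros P) auto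
    moreover have "(0 / (0 + a) ^ (m + 2) + (real m + 1) * ((harm m - ln a) / ((real m + 1) * a ^ (m + 1)))
                  + 1 / ((real m + 1) * (0 + a) ^ (m + 1))) / ((real m + 2) * a)
      = (harm (Suc m) - ln a) / ((real (Suc m) + 1) * a ^ (Suc m + 1))"
      using assms by (simp add: harm_Suc divide_simps) (simp add: algebra_simps)
    ultimately show ?thesis by simp
  qed
  moreover have "(?P \<longlongrightarrow> 0) at_top"
  proof -
    have 1: "((\<lambda>x. x * ln x / (x + a) ^ 2) \<longlongrightarrow> 0) at_top" and 2: "((\<lambda>x. 1 / (x + a)) \<longlongrightarrow> 0) at_top"
      using assms by real_asymp+
    \<comment> \<open>The symbolic powers are split into a square and powers of
      \<open>1 / (x + a)\<close>, so that only limits with fixed exponents enter. For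
      \<open>m = 0\<close> the factor \<open>0 ^ m\<close> is 1, but the other factor is still
      0.\<close>
    have "((\<lambda>x. (x * ln x / (x + a) ^ 2 * (1 / (x + a)) ^ m + (real m + 1) * P x
                  + (1 / (x + a)) ^ (m + 1) / (real m + 1)) / ((real m + 2) * a))
       \<longlongrightarrow> (0 * 0 ^ m + (real m + 1) * 0 + 0 ^ (m + 1) / (real m + 1)) / ((real m + 2) * a)) at_top"
      using assms by (intro tendsto_intros P 1 2) auto
    then show ?thesis
      by (simp add: power_divide power_add power2_eq_square mult.commute mult.left_commute)
  qed
  ultimately show ?case by blast
qed

text \<open>The integrand has the sign of \<open>ln x\<close>, so the sign-change version applies,
  and the value is minus the limit of the antiderivative at 0.\<close>

lemma ln_over_power:
  fixes a :: real and m :: nat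
  assumes "a > 0"
  shows has_integral_ln_over_power: "((\<lambda>x. ln x / (x + a) ^ (m + 2)) has_integral
           ((ln a - harm m) / ((real m + 1) * a ^ (m + 1)))) {0<..}"
    and absolutely_integrable_ln_over_power:
          "(\<lambda>x. ln x / (x + a) ^ (m + 2)) absolutely_integrable_on {0<..}"
proof -
  obtain P where P: "\<And>x. x > 0 \<Longrightarrow> DERIV P x :> ln x / (x + a) ^ (m + 2)"
    "(P \<longlongrightarrow> (harm m - ln a) / ((real m + 1) * a ^ (m + 1))) (at_right 0)" "(P \<longlongrightarrow> 0) at_top"
    using antiderivative_ln_over_power[OF assms] by blast
  have "((\<lambda>x. ln x / (x + a) ^ (m + 2)) has_integral
           (0 - (harm m - ln a) / ((real m + 1) * a ^ (m + 1)))) {0<..}"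
    by (rule has_integral_FTC_Ioi_sign_change[OF P(1) _ _ _ P(2,3)])
       (use assms in \<open>auto simp del: power_Suc intro!: divide_nonpos_pos continuous_intros\<close>)
  then show "((\<lambda>x. ln x / (x + a) ^ (m + 2)) has_integral
           ((ln a - harm m) / ((real m + 1) * a ^ (m + 1)))) {0<..}"
    by (simp add: minus_divide_left del: power_Suc)
  show "(\<lambda>x. ln x / (x + a) ^ (m + 2)) absolutely_integrable_on {0<..}"
    by (rule has_integral_FTC_Ioi_sign_change[OF P(1) _ _ _ P(2,3)])
       (use assms in \<open>auto simp del: power_Suc intro!: divide_nonpos_pos continuous_intros\<close>)
qed

section \<open>The substitutions \<open>a / x\<close> and \<open>1 / x\<close>\<close>

lemma has_integral_Ioi_reflect:
  fixes f :: "real \<Rightarrow> real" and a :: real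
  assumes "a > 0" and "f absolutely_integrable_on {0<..}"
  shows "((\<lambda>x. a / x\<^sup>2 * f (a / x)) has_integral (integral {0<..} f)) {0<..}"
proof -
  have img: "(\<lambda>x. a / x) ` {0<..} = {0<..}"
    using assms(1) by (auto simp: image_iff intro!: bexI[of _ "a / x" for x])
  have "(\<lambda>x. \<bar>- (a / x\<^sup>2)\<bar> * f (a / x)) absolutely_integrable_on {0<..} \<and>
        integral {0<..} (\<lambda>x. \<bar>- (a / x\<^sup>2)\<bar> * f (a / x)) = integral {0<..} f"
    using assms img
    by (subst has_absolute_integral_change_of_variables_1')
       (auto intro!: derivative_eq_intros inj_onI simp: power2_eq_square)
  then show ?thesis
    using assms(1) by (simp add: has_integral_iff absolutely_integrable_on_def)
qed

text \<open>Nonnegativity upgrades integrability to the absolute integrability that the change of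
  variables requires.\<close>

lemma has_integral_Ioo_reflect:
  fixes f :: "real \<Rightarrow> real"
  assumes "(f has_integral I) {0<..<1}" and "\<And>x. x \<in> {0<..<1} \<Longrightarrow> 0 \<le> f x"
  shows "((\<lambda>x. f (1 / x) / x\<^sup>2) has_integral I) {1<..}"
proof -
  have img: "(\<lambda>x. 1 / x) ` {1<..} = {0<..<1::real}"
    by (auto simp: image_iff intro!: bexI[of _ "1 / x" for x])
  have "f absolutely_integrable_on {0<..<1}" "integral {0<..<1} f = I"
    using assms by (auto intro: nonnegative_absolutely_integrable_1)
  then have "(\<lambda>x. \<bar>- (1 / x\<^sup>2)\<bar> * f (1 / x)) absolutely_integrable_on {1<..} \<and>
        integral {1<..} (\<lambda>x. \<bar>- (1 / x\<^sup>2)\<bar> * f (1 / x)) = I"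
    using img
    by (subst has_absolute_integral_change_of_variables_1')
       (auto intro!: derivative_eq_intros inj_onI simp: power2_eq_square)
  then show ?thesis
    by (simp add: has_integral_iff absolutely_integrable_on_def)
qed

section \<open>The base integral for \<open>a = 1\<close>\<close>

text \<open>Group the inverse squares in consecutive pairs: the even ones form a quarter of the
  whole series, leaving three quarters of \<open>pi^2 / 6\<close>.\<close>

lemma inverse_odd_squares_sums: "(\<lambda>n. 1 / (2 * real n + 1)\<^sup>2) sums (pi\<^sup>2 / 8)"
proof -
  let ?f = "\<lambda>n::nat. 1 / (real n + 1)\<^sup>2"
  have f: "?f sums (pi\<^sup>2 / 6)"
    using inverse_squares_sums by (simp add: add.commute)
  have "(\<lambda>n. sum ?f {n * 2..<n * 2 + 2}) sums (pi\<^sup>2 / 6)"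
    by (rule sums_group[OF f]) simp
  moreover have "sum ?f {n * 2..<n * 2 + 2} = 1 / (2 * real n + 1)\<^sup>2 + ?f n / 4" for n
  proof -
    have "{n * 2..<n * 2 + 2} = {2 * n, 2 * n + 1}" by auto
    moreover have "(real (2 * n + 1) + 1)\<^sup>2 = 4 * (real n + 1)\<^sup>2"
      by (simp add: power2_eq_square algebra_simps)
    ultimately show ?thesis by (simp add: mult.commute)
  qed
  ultimately have "(\<lambda>n. 1 / (2 * real n + 1)\<^sup>2 + ?f n / 4) sums (pi\<^sup>2 / 6)"
    by simp
  from sums_diff[OF this sums_divide[OF f, of 4]] show ?thesis by simp
qed

lemma has_integral_power_ln_unit:
  "((\<lambda>x. - (x ^ m * ln x)) has_integral (1 / (real m + 1)\<^sup>2)) {0<..<1::real}"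
proof -
  \<comment> \<open>Integration by parts. Keeping \<open>x * ln x\<close> together makes the limit
    at 0 immediate even for \<open>m = 0\<close>; for differentiation the powers are merged
    again.\<close>
  let ?F = "\<lambda>x::real. x ^ (m + 1) / (real m + 1)\<^sup>2 - x ^ m * (x * ln x) / (real m + 1)"
  have "((\<lambda>x. - (x ^ m * ln x)) has_integral (1 / (real m + 1)\<^sup>2 - 0)) {0<..<1::real}"
  proof (rule has_integral_FTC_Ioo_nonneg[where F = ?F])
    show "DERIV ?F x :> - (x ^ m * ln x)" if "0 < x" "x < 1" for x
    proof -
      have "x ^ m * (x * ln x) = x ^ (m + 1) * ln x" for x :: real by simp
      then have F: "?F = (\<lambda>x. x ^ (m + 1) / (real m + 1)\<^sup>2 - x ^ (m + 1) * ln x / (real m + 1))"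
        by (simp only:)
      have "DERIV (\<lambda>x. x ^ (m + 1)) x :> (real m + 1) * x ^ m"
        by (rule DERIV_cong[OF DERIV_pow]) simp
      note D = DERIV_diff[OF DERIV_cdivide[OF this, of "(real m + 1)\<^sup>2"]
          DERIV_cdivide[OF DERIV_mult[OF this DERIV_ln_divide[OF that(1)]], of "real m + 1"]]
      have "(real m + 1) * x ^ m / (real m + 1)\<^sup>2
            - ((real m + 1) * x ^ m * ln x + 1 / x * x ^ (m + 1)) / (real m + 1) = - (x ^ m * ln x)"
      proof -
        have "(c * p / c\<^sup>2) - (c * p * l + 1 / x * (x * p)) / c = - (p * l)" if "c \<noteq> 0" for c p l :: real
          using that \<open>0 < x\<close> by (simp add: divide_simps power2_eq_square)
        from this[of "real m + 1" "x ^ m" "ln x"] show ?thesis by simp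
      qed
      with D show ?thesis unfolding F by (rule DERIV_cong)
    qed
    have "((\<lambda>x::real. x * ln x) \<longlongrightarrow> 0) (at_right 0)" by real_asymp
    then have "(?F \<longlongrightarrow> 0 ^ (m + 1) / (real m + 1)\<^sup>2 - 0 ^ m * 0 / (real m + 1)) (at_right 0)"
      by (intro tendsto_intros) auto
    then show "(?F \<longlongrightarrow> 0) (at_right 0)" by simp
    have "(?F \<longlongrightarrow> 1 ^ (m + 1) / (real m + 1)\<^sup>2 - 1 ^ m * (1 * ln 1) / (real m + 1)) (at_left 1)"
      by (intro tendsto_intros) auto
    then show "(?F \<longlongrightarrow> 1 / (real m + 1)\<^sup>2) (at_left 1)" by simp
  qed (auto intro!: continuous_intros simp: mult_nonneg_nonpos)
  then show ?thesis by simp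
qed

text \<open>Expand \<open>1 / (1 - x^2)\<close> geometrically. Every term
  \<open>- (x ^ (2 * n) * ln x)\<close> is nonnegative on (0, 1), so monotone convergence permits
  termwise integration and gives the inverse odd squares.\<close>

lemma has_integral_ln_over_square_minus_one_unit:
  "((\<lambda>x. ln x / ((x - 1) * (x + 1))) has_integral (pi\<^sup>2 / 8)) {0<..<1::real}"
proof (rule has_integral_monotone_convergence_increasing)
  let ?f = "\<lambda>N x::real. \<Sum>n<N. - (x ^ (2 * n) * ln x)"
  show "(?f N has_integral (\<Sum>n<N. 1 / (2 * real n + 1)\<^sup>2)) {0<..<1}" for N
    using has_integral_power_ln_unit[of "2 * n" for n]
    by (intro has_integral_sum) simp_all
  show "?f N x \<le> ?f (Suc N) x" if "x \<in> {0<..<1}" for N x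
    using that by (simp add: mult_nonneg_nonpos)
  show "(\<lambda>N. ?f N x) \<longlonglongrightarrow> ln x / ((x - 1) * (x + 1))" if "x \<in> {0<..<1}" for x
  proof -
    have "x\<^sup>2 < 1" using that by (simp add: power_less_one_iff)
    then have "(\<lambda>n. (x\<^sup>2) ^ n * - ln x) sums (1 / (1 - x\<^sup>2) * - ln x)"
      by (intro sums_mult2 geometric_sums) simp
    moreover have "1 / (1 - x\<^sup>2) * - ln x = ln x / ((x - 1) * (x + 1))"
      using that \<open>x\<^sup>2 < 1\<close> by (simp add: divide_simps) (simp add: algebra_simps power2_eq_square)
    ultimately show ?thesis by (simp add: sums_def power_mult)
  qed
  show "(\<lambda>N. \<Sum>n<N. 1 / (2 * real n + 1)\<^sup>2) \<longlonglongrightarrow> pi\<^sup>2 / 8"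
    using inverse_odd_squares_sums by (simp add: sums_def)
qed

text \<open>The integrand satisfies \<open>f (1 / x) / x^2 = f x\<close>, so both sides of 1
  contribute equally.\<close>

lemma has_integral_ln_over_square_minus_one:
  "((\<lambda>x::real. ln x / ((x - 1) * (x + 1))) has_integral (pi\<^sup>2 / 4)) {0<..}"
proof -
  let ?f = "\<lambda>x::real. ln x / ((x - 1) * (x + 1))"
  have "0 \<le> ?f x" if "x \<in> {0<..<1}" for x
    using that by (intro divide_nonpos_neg mult_neg_pos) auto
  then have "((\<lambda>x. ?f (1 / x) / x\<^sup>2) has_integral (pi\<^sup>2 / 8)) {1<..}"
    by (intro has_integral_Ioo_reflect has_integral_ln_over_square_minus_one_unit)
  then have "(?f has_integral (pi\<^sup>2 / 8)) {1<..}"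
  proof (rule has_integral_eq[rotated])
    fix x :: real assume "x \<in> {1<..}"
    then show "?f (1 / x) / x\<^sup>2 = ?f x"
      by (simp add: ln_div divide_simps) (simp add: algebra_simps power2_eq_square)
  qed
  from has_integral_Ioi_split[OF has_integral_ln_over_square_minus_one_unit this]
  show ?thesis by simp
qed

section \<open>The base integral for general \<open>a\<close>\<close>

text \<open>Partial fractions with distinct poles. This is the integral that remains once the
  logarithm has been averaged out.\<close>

lemma has_integral_one_over_two_linear:
  fixes a :: real
  assumes "a > 0" "a \<noteq> 1"
  shows "((\<lambda>x. 1 / ((x + 1) * (x + a))) has_integral (ln a / (a - 1))) {0<..}"
proof -
  have "((\<lambda>x. 1 / ((x + 1) * (x + a))) has_integral (0 - (- ln a / (a - 1)))) {0<..}"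
  proof (rule has_integral_FTC_Ioi_nonneg[where F = "\<lambda>x. (ln (x + 1) - ln (x + a)) / (a - 1)"])
    show "DERIV (\<lambda>x. (ln (x + 1) - ln (x + a)) / (a - 1)) x :> 1 / ((x + 1) * (x + a))" if "0 < x" for x
    proof -
      have "x + 1 > 0" "x + a > 0" using that assms by auto
      have "DERIV (\<lambda>x. (ln (x + 1) - ln (x + a)) / (a - 1)) x :> (1 / (x + 1) - 1 / (x + a)) / (a - 1)"
        using that assms by (auto intro!: derivative_eq_intros)
      also have "(1 / (x + 1) - 1 / (x + a)) / (a - 1) = 1 / ((x + 1) * (x + a))"
        using \<open>x + 1 > 0\<close> \<open>x + a > 0\<close> assms by (simp add: divide_simps)
      finally show ?thesis .
    qed
    have "((\<lambda>x. (ln (x + 1) - ln (x + a)) / (a - 1)) \<longlongrightarrow> (ln (0 + 1) - ln (0 + a)) / (a - 1)) (at_right 0)"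
      using assms by (intro tendsto_intros) auto
    then show "((\<lambda>x. (ln (x + 1) - ln (x + a)) / (a - 1)) \<longlongrightarrow> - ln a / (a - 1)) (at_right 0)" by simp
    have "((\<lambda>x. ln (x + 1) - ln (x + a)) \<longlongrightarrow> 0) at_top" using assms by real_asymp
    from tendsto_divide[OF this tendsto_const[of "a - 1"]] assms
    show "((\<lambda>x. (ln (x + 1) - ln (x + a)) / (a - 1)) \<longlongrightarrow> 0) at_top" by simp
  qed (use assms in \<open>auto intro!: continuous_intros\<close>)
  then show ?thesis by simp
qed

text \<open>Since \<open>min 1 a * (x + 1) \<le> x + a\<close>, a multiple of
  \<open>\<bar>ln x\<bar> / (x + 1)^2\<close> dominates. The substitution \<open>a / x\<close> needs
  this absolute integrability.\<close>

lemma absolutely_integrable_ln_over_two_linear: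
  fixes a :: real
  assumes "a > 0"
  shows "(\<lambda>x. ln x / ((x + 1) * (x + a))) absolutely_integrable_on {0<..}"
proof (rule measurable_bounded_by_integrable_imp_absolutely_integrable)
  show "(\<lambda>x. ln x / ((x + 1) * (x + a))) \<in> borel_measurable (lebesgue_on {0<..})"
    by (rule continuous_imp_measurable_on_sets_lebesgue)
       (use assms in \<open>auto intro!: continuous_intros\<close>)
  let ?g = "\<lambda>x. \<bar>ln x / (x + 1) ^ (0 + 2)\<bar> / min 1 a"
  show "?g integrable_on {0<..}"
    using absolutely_integrable_ln_over_power[of 1 0] 
    by (intro integrable_on_divide) (simp add: absolutely_integrable_on_def)
  show "norm (ln x / ((x + 1) * (x + a))) \<le> ?g x" if "x \<in> {0<..}" for x
  proof -
    have x: "x > 0" using that by simp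
    have "min 1 a * (x + 1) = min 1 a * x + min 1 a" by (simp add: algebra_simps)
    also have "min 1 a * x \<le> 1 * x" using x by (intro mult_right_mono) auto
    finally have "min 1 a * (x + 1) \<le> x + a" by linarith
    then have "(x + 1) * (min 1 a * (x + 1)) \<le> (x + 1) * (x + a)"
      using x by (intro mult_left_mono) auto
    then have "\<bar>ln x\<bar> / ((x + 1) * (x + a)) \<le> \<bar>ln x\<bar> / ((x + 1) * (min 1 a * (x + 1)))"
      using x assms by (intro divide_left_mono) auto
    then show ?thesis
      using x assms by (simp add: abs_mult power2_eq_square mult_ac)
  qed
qed auto

text \<open>The substitution \<open>x \<mapsto> a / x\<close> turns \<open>ln x\<close> into \<open>ln a - ln x\<close> and preserves the rest of the
  integrand, so averaging the two forms removes the logarithm.\<close>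

lemma has_integral_ln_over_two_linear:
  fixes a :: real
  assumes "a > 0"
  shows "((\<lambda>x. (a - 1) * (ln x / ((x + 1) * (x + a)))) has_integral ((ln a)\<^sup>2 / 2)) {0<..}"
\<comment> \<open>For \<open>a = 1\<close> both \<open>a - 1\<close> and \<open>ln a\<close>
  vanish.\<close>
proof (cases "a = 1")
  case False
  let ?f = "\<lambda>x. ln x / ((x + 1) * (x + a))"
  define K where "K = integral {0<..} ?f"
  note abs_int = absolutely_integrable_ln_over_two_linear[OF assms]
  have f: "(?f has_integral K) {0<..}"
    unfolding K_def using abs_int by (simp add: absolutely_integrable_on_def has_integral_integral)
  have "((\<lambda>x. a / x\<^sup>2 * ?f (a / x)) has_integral K) {0<..}"
    unfolding K_def by (rule has_integral_Ioi_reflect[OF assms abs_int])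
  then have "((\<lambda>x. ln a * (1 / ((x + 1) * (x + a))) - ?f x) has_integral K) {0<..}"
  proof (rule has_integral_eq[rotated])
    fix x :: real assume "x \<in> {0<..}"
    then have x: "x > 0" by simp
    have "a / x\<^sup>2 * ?f (a / x) = (ln a - ln x) / ((x + 1) * (x + a))"
    proof -
      have "(a / x + 1) * (a / x + a) = a / x\<^sup>2 * ((x + 1) * (x + a))"
        using x by (simp add: divide_simps) (simp add: algebra_simps power2_eq_square)
      then show ?thesis using x assms by (simp add: ln_div)
    qed
    then show "a / x\<^sup>2 * ?f (a / x) = ln a * (1 / ((x + 1) * (x + a))) - ?f x"
      by (simp add: diff_divide_distrib)
  qed
  moreover have "((\<lambda>x. ln a * (1 / ((x + 1) * (x + a))) - ?f x) has_integral
      (ln a * (ln a / (a - 1)) - K)) {0<..}"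
    by (intro has_integral_diff has_integral_mult_right has_integral_one_over_two_linear assms False f)
  ultimately have "K = ln a * (ln a / (a - 1)) - K"
    by (rule has_integral_unique)
  then have "(a - 1) * K = (ln a)\<^sup>2 / 2"
    using False by (simp add: field_simps power2_eq_square)
  with has_integral_mult_right[OF f, of "a - 1"] show ?thesis by simp
qed simp

text \<open>The identity behind it is \<open>(a + 1) / ((x - 1) * (x + a)) = 2 / ((x - 1) * (x + 1))
  + (a - 1) / ((x + 1) * (x + a))\<close>, valid away from the poles.\<close>

lemma has_integral_ln_over_linear:
  fixes a :: real
  assumes "a > 0"
  shows "((\<lambda>x. ln x / ((x - 1) * (x + a))) has_integral ((pi\<^sup>2 + (ln a)\<^sup>2) / (2 * (a + 1)))) {0<..}"
proof -
  have "((\<lambda>x. (2 * (ln x / ((x - 1) * (x + 1))) + (a - 1) * (ln x / ((x + 1) * (x + a)))) / (a + 1))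
      has_integral ((2 * (pi\<^sup>2 / 4) + (ln a)\<^sup>2 / 2) / (a + 1))) {0<..}"
    by (intro has_integral_divide has_integral_add has_integral_mult_right
        has_integral_ln_over_square_minus_one has_integral_ln_over_two_linear assms)
  moreover have "(2 * (pi\<^sup>2 / 4) + (ln a)\<^sup>2 / 2) / (a + 1) = (pi\<^sup>2 + (ln a)\<^sup>2) / (2 * (a + 1))"
    using assms by (simp add: field_simps)
  ultimately have "((\<lambda>x. (2 * (ln x / ((x - 1) * (x + 1))) + (a - 1) * (ln x / ((x + 1) * (x + a)))) / (a + 1))
      has_integral ((pi\<^sup>2 + (ln a)\<^sup>2) / (2 * (a + 1)))) {0<..}"
    by simp
  then show ?thesis
  proof (rule has_integral_eq[rotated])
    fix x :: real assume x: "x \<in> {0<..}"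
    show "(2 * (ln x / ((x - 1) * (x + 1))) + (a - 1) * (ln x / ((x + 1) * (x + a)))) / (a + 1)
        = ln x / ((x - 1) * (x + a))"
    \<comment> \<open>At 1 both sides are 0, because \<open>ln 1 = 0\<close> and division by zero
      yields 0.\<close>
    proof (cases "x = 1")
      case False
      with x assms have "x - 1 \<noteq> 0" "x + 1 \<noteq> 0" "x + a \<noteq> 0" "a + 1 \<noteq> 0" by auto
      then show ?thesis by (simp add: divide_simps) (simp add: algebra_simps)
    qed simp
  qed
qed

section \<open>Higher powers and the closed form\<close>

text \<open>Multiplied by \<open>(a + 1) ^ (n + 1)\<close>, the recursion \<open>(a + 1)
  G\<^sub>n\<^sub>+\<^sub>2 = G\<^sub>n\<^sub>+\<^sub>1 - L\<^sub>n\<^sub>+\<^sub>2\<close>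
  telescopes. The summand for \<open>j\<close> is \<open>L\<^sub>j\<^sub>+\<^sub>2\<close> times
  \<open>- (a + 1) ^ (j + 1)\<close>, which merges with \<open>1 / a ^ (j + 1)\<close> into a power
  of \<open>1 + 1 / a\<close>.\<close>

lemma has_integral_ln_over_linear_power:
  fixes a :: real
  assumes "a > 0"
  shows "((\<lambda>x. ln x / ((x - 1) * (x + a) ^ (n + 1))) has_integral
     ((pi\<^sup>2 + (ln a)\<^sup>2) / (2 * (a + 1) ^ (n + 1))
      + (\<Sum>j<n. (1 + 1 / a) ^ (j + 1) / (real j + 1) * (harm j - ln a)) / (a + 1) ^ (n + 1))) {0<..}"
proof (induction n)
  case 0
  show ?case using has_integral_ln_over_linear[OF assms] by simp
next
  case (Suc n)
  let ?S = "\<lambda>n. \<Sum>j<n. (1 + 1 / a) ^ (j + 1) / (real j + 1) * (harm j - ln a)"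
  let ?C = "pi\<^sup>2 + (ln a)\<^sup>2"
  have a: "a \<noteq> 0" "a + 1 \<noteq> 0" using assms by auto
  have "((\<lambda>x. (ln x / ((x - 1) * (x + a) ^ (n + 1)) - ln x / (x + a) ^ (n + 2)) / (a + 1)) has_integral
      ((?C / (2 * (a + 1) ^ (n + 1)) + ?S n / (a + 1) ^ (n + 1)
        - (ln a - harm n) / ((real n + 1) * a ^ (n + 1))) / (a + 1))) {0<..}"
    by (intro has_integral_divide has_integral_diff Suc has_integral_ln_over_power assms)
  also have "(?C / (2 * (a + 1) ^ (n + 1)) + ?S n / (a + 1) ^ (n + 1)
        - (ln a - harm n) / ((real n + 1) * a ^ (n + 1))) / (a + 1)
      = ?C / (2 * (a + 1) ^ (Suc n + 1)) + ?S (Suc n) / (a + 1) ^ (Suc n + 1)"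
  proof -
    have q: "1 + 1 / a = (a + 1) / a" using a by (simp add: field_simps)
    have "?S (Suc n) / (a + 1) ^ (Suc n + 1) = (?S n / (a + 1) ^ (n + 1)
        - (ln a - harm n) / ((real n + 1) * a ^ (n + 1))) / (a + 1)"
      unfolding q sum.lessThan_Suc power_divide using a
      by (simp add: divide_simps del: sum.lessThan_Suc) (simp add: algebra_simps)
    moreover have "?C / (2 * (a + 1) ^ (Suc n + 1)) = ?C / (2 * (a + 1) ^ (n + 1)) / (a + 1)"
      by simp
    ultimately show ?thesis
      by (simp only: add_divide_distrib diff_divide_distrib)
  qed
  finally show ?case
  proof (rule has_integral_eq[rotated])
    fix x :: real assume x: "x \<in> {0<..}"
    show "(ln x / ((x - 1) * (x + a) ^ (n + 1)) - ln x / (x + a) ^ (n + 2)) / (a + 1)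
        = ln x / ((x - 1) * (x + a) ^ (Suc n + 1))"
    proof (cases "x = 1")
      case False
      with x assms have "x - 1 \<noteq> 0" "x + a \<noteq> 0" by auto
      with a show ?thesis by (simp add: divide_simps) (simp add: algebra_simps)
    qed simp
  qed
qed

text \<open>Summation by parts: with \<open>q = 1 + 1 / a\<close> one has
  \<open>q / (a + 1) = q - 1\<close>, so \<open>q ^ (j + 1) / (a + 1)\<close> is the difference
  \<open>q ^ (j + 1) - q ^ j\<close>, while \<open>harm\<close> has increments
  \<open>1 / (j + 1)\<close>.\<close>

lemma sum_power_harm:
  fixes a l :: real
  assumes "a > 0"
  shows "(\<Sum>j<k. (1 + 1 / a) ^ (j + 1) * (harm j - l)) / (a + 1)
         = (1 + 1 / a) ^ k * (harm k - l) + l - (\<Sum>j<k. (1 + 1 / a) ^ (j + 1) / (real j + 1))"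
proof (induction k)
  case 0
  show ?case by (simp add: harm_def)
next
  case (Suc k)
  define q where "q = 1 + 1 / a"
  have "q = (a + 1) / a" using assms by (simp add: q_def field_simps)
  then have q: "q / (a + 1) = q - 1" using assms by (simp add: q_def)
  have "q ^ (k + 1) * (harm k - l) / (a + 1) = q ^ k * (harm k - l) * (q / (a + 1))" by simp
  also have "\<dots> = q ^ (k + 1) * (harm k - l) - q ^ k * (harm k - l)"
    unfolding q by (simp add: algebra_simps)
  also have "\<dots> = q ^ (k + 1) * (harm (Suc k) - l) - q ^ (k + 1) / (real k + 1) - q ^ k * (harm k - l)"
  proof -
    have h: "harm (Suc k) = harm k + 1 / (real k + 1)"
      by (simp add: harm_Suc inverse_eq_divide add.commute)
    show ?thesis unfolding h by (simp add: algebra_simps)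
  qed
  finally show ?case
    using Suc by (simp add: add_divide_distrib q_def[symmetric])
qed

theorem theorem7:
  fixes k :: nat and a :: real
  assumes "a > 0"
  shows "((\<lambda>x::real. x * ln x / ((x - 1) * (x + a) ^ (k + 2))) has_integral
     ((pi\<^sup>2 + (ln a)\<^sup>2) / (2 * (a + 1) ^ (k + 2))
      + ln a / ((real k + 1) * (a + 1) ^ (k + 1))
      + 1 / ((real k + 1) * (a + 1) ^ (k + 1)) *
        (\<Sum>j<k. (1 + 1 / a) ^ (j + 1) / (real j + 1) *
           ((real k - real j) / (a + 1) * (harm j - ln a) - 1))))
     {0<..}"
proof -
  define q where "q = 1 + 1 / a"
  define l where "l = ln a"
  define C where "C = (pi\<^sup>2 + (ln a)\<^sup>2) / (2 * (a + 1) ^ (k + 2))"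
  define s where "s j = q ^ (j + 1) / (real j + 1) * (harm j - l)" for j
  define D where "D = (a + 1) ^ (k + 1)"
  have pos: "a \<noteq> 0" "a + 1 \<noteq> 0" "real k + 1 \<noteq> 0" "D \<noteq> 0"
    using assms by (auto simp: D_def add_nonneg_eq_0_iff)
  \<comment> \<open>The splitting \<open>x = (x - 1) + 1\<close>; the exponent
    \<open>k + 1 + 1\<close> is the instance \<open>n = k + 1\<close> of the preceding
    integral.\<close>
  have "((\<lambda>x. ln x / (x + a) ^ (k + 2) + ln x / ((x - 1) * (x + a) ^ (k + 1 + 1))) has_integral
      ((ln a - harm k) / ((real k + 1) * a ^ (k + 1)) +
       (C + (\<Sum>j<k + 1. s j) / (a + 1) ^ (k + 1 + 1)))) {0<..}"
    unfolding C_def s_def q_def l_def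
    using has_integral_ln_over_linear_power[OF assms, of "k + 1"]
    by (intro has_integral_add has_integral_ln_over_power assms) simp
  then have "((\<lambda>x. x * ln x / ((x - 1) * (x + a) ^ (k + 2))) has_integral
      ((ln a - harm k) / ((real k + 1) * a ^ (k + 1)) +
       (C + (\<Sum>j<k + 1. s j) / (a + 1) ^ (k + 1 + 1)))) {0<..}"
  proof (rule has_integral_eq[rotated])
    fix x :: real assume x: "x \<in> {0<..}"
    show "ln x / (x + a) ^ (k + 2) + ln x / ((x - 1) * (x + a) ^ (k + 1 + 1))
        = x * ln x / ((x - 1) * (x + a) ^ (k + 2))"
    proof (cases "x = 1")
      case False
      with x assms have "x - 1 \<noteq> 0" "x + a \<noteq> 0" by auto
      then show ?thesis by (simp add: divide_simps) (simp add: algebra_simps)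
    qed simp
  qed
  moreover have "(ln a - harm k) / ((real k + 1) * a ^ (k + 1)) + (C + (\<Sum>j<k + 1. s j) / (a + 1) ^ (k + 1 + 1))
     = C + l / ((real k + 1) * D) + 1 / ((real k + 1) * D) *
        (\<Sum>j<k. q ^ (j + 1) / (real j + 1) * ((real k - real j) / (a + 1) * (harm j - l) - 1))"
  proof -
    define T where "T = (\<Sum>j<k. s j)"
    define U where "U = (\<Sum>j<k. q ^ (j + 1) * (harm j - l))"
    define V where "V = (\<Sum>j<k. q ^ (j + 1) / (real j + 1))"
    have UV: "U / (a + 1) = q ^ k * (harm k - l) + l - V"
      unfolding U_def V_def q_def by (rule sum_power_harm[OF assms])
    \<comment> \<open>From \<open>(k - j) / (j + 1) = (k + 1) / (j + 1) - 1\<close>: the constant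
      part loses its denominator and becomes summable by parts.\<close>
    have "q ^ (j + 1) / (real j + 1) * ((real k - real j) / (a + 1) * (harm j - l) - 1)
        = (real k + 1) / (a + 1) * s j - q ^ (j + 1) * (harm j - l) / (a + 1) - q ^ (j + 1) / (real j + 1)" for j
    proof -
      have "real j + 1 \<noteq> 0" by (simp add: add_nonneg_eq_0_iff)
      then show ?thesis unfolding s_def using pos(2) by (simp add: divide_simps) (simp add: algebra_simps)
    qed
    then have "(\<Sum>j<k. q ^ (j + 1) / (real j + 1) * ((real k - real j) / (a + 1) * (harm j - l) - 1))
       = (real k + 1) / (a + 1) * T - U / (a + 1) - V"
      by (simp only: T_def U_def V_def sum_subtractf sum_distrib_left sum_divide_distrib)
    \<comment> \<open>The sum \<open>V\<close> cancels; the remaining \<open>- l\<close> will cancel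
      the separate \<open>ln a\<close> term of the claim.\<close>
    also have "\<dots> = (real k + 1) / (a + 1) * T - q ^ k * (harm k - l) - l"
      unfolding UV by simp
    finally have S: "(\<Sum>j<k. q ^ (j + 1) / (real j + 1) * ((real k - real j) / (a + 1) * (harm j - l) - 1))
       = (real k + 1) / (a + 1) * T - q ^ k * (harm k - l) - l" .
    have qa: "q = (a + 1) / a" using pos by (simp add: q_def field_simps)
    have aD: "1 / a ^ (k + 1) = q ^ (k + 1) / D"
      unfolding D_def qa power_divide using pos by simp
    \<comment> \<open>Up to the factor \<open>- 1 / D\<close>, the integral
      \<open>L\<^sub>k\<^sub>+\<^sub>2\<close> is the top summand \<open>s k\<close>.\<close>
    have "(ln a - harm k) / ((real k + 1) * a ^ (k + 1)) = (l - harm k) / (real k + 1) * (1 / a ^ (k + 1))"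
      by (simp add: l_def)
    also have "\<dots> = - s k / D"
      unfolding aD s_def by (simp add: minus_divide_left algebra_simps)
    finally have 1: "(ln a - harm k) / ((real k + 1) * a ^ (k + 1)) = - s k / D" .
    have sk: "s k = (a + 1) / a * (q ^ k * (harm k - l)) / (real k + 1)"
      unfolding s_def qa by simp
    have D: "(a + 1) ^ (k + 1 + 1) = (a + 1) * D" by (simp add: D_def)
    have T1: "(\<Sum>j<k + 1. s j) = T + s k" by (simp add: T_def)
    define w where "w = q ^ k * (harm k - l)"
    \<comment> \<open>The two occurrences of \<open>s k\<close> combine to
      \<open>- s k * a / ((a + 1) * D)\<close>, which is \<open>- w / ((k + 1) * D)\<close> because
      \<open>q * a = a + 1\<close>.\<close>
    show ?thesis
      unfolding S 1 D T1 sk w_def[symmetric] using pos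
      by (simp add: divide_simps) (simp add: algebra_simps)
  qed
  ultimately show ?thesis
    unfolding C_def D_def q_def l_def by (simp only:)
qed

end
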